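(* Let $\mathcal{M}^{PC}(\boldsymbol{\theta},\boldsymbol{\xi})=\sum_{\boldsymbol{\alpha}\in\mathcal{A}^{M,p}} y_{\boldsymbol{\alpha}}\Psi_{\boldsymbol{\alpha}}(\boldsymbol{\theta},\boldsymbol{\xi})$ be a truncated polynomial chaos expansion in $\boldsymbol{X}=(\boldsymbol{\theta},\boldsymbol{\xi})$ with real coefficients $y_{\boldsymbol{\alpha}}$. Write each multi-index as $\boldsymbol{\alpha}=(\boldsymbol{\alpha}_K,\boldsymbol{\alpha}_L)\in\mathbb{N}^K\times\mathbb{N}^L$, so that $\Psi_{\boldsymbol{\alpha}}(\boldsymbol{\theta},\boldsymbol{\xi})=\Psi_{\boldsymbol{\alpha}_K}(\boldsymbol{\theta})\,\Psi_{\boldsymbol{\alpha}_L}(\boldsymbol{\xi})$. For each $\boldsymbol{\alpha}_L\in\mathbb{N}^L$ with $|\boldsymbol{\alpha}_L|\le p$ define $$c_{\boldsymbol{\alpha}_L}(\boldsymbol{\theta})=\sum_{\boldsymbol{\alpha}_K:\,(\boldsymbol{\alpha}_K,\boldsymbol{\alpha}_L)\in\mathcal{A}^{M,p}} y_{\boldsymbol{\alpha}_K,\boldsymbol{\alpha}_L}\,\Psi_{\boldsymbol{\alpha}_K}(\boldsymbol{\theta}).$$ Then for every fixed value of $\boldsymbol{\theta}$, the function $\mathcal{M}^{PC}(\boldsymbol{\xi}\mid\boldsymbol{\theta}):=\mathcal{M}^{PC}(\boldsymbol{\theta},\boldsymbol{\xi})$ of $\boldsymbol{\xi}$ satisfies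 $$\mathcal{M}^{PC}(\boldsymbol{\xi}\mid\boldsymbol{\theta})=\sum_{\boldsymbol{\alpha}_L\in\mathbb{N}^L,\ |\boldsymbol{\alpha}_L|\le p} c_{\boldsymbol{\alpha}_L}(\boldsymbol{\theta})\,\Psi_{\boldsymbol{\alpha}_L}(\boldsymbol{\xi}),$$ and the functions $\Psi_{\boldsymbol{\alpha}_L}$ are orthonormal with respect to the (conditional) law of $\boldsymbol{\xi}$ given $\boldsymbol{\theta}$: for all such $\boldsymbol{\alpha}_L,\boldsymbol{\beta}_L$, $$\langle\Psi_{\boldsymbol{\alpha}_L},\Psi_{\boldsymbol{\beta}_L}\rangle_{\boldsymbol{\xi}}=\mathbb{E}\left[\Psi_{\boldsymbol{\alpha}_L}(\boldsymbol{\xi})\Psi_{\boldsymbol{\beta}_L}(\boldsymbol{\xi})\right]=\delta_{\boldsymbol{\alpha}_L\boldsymbol{\beta}_L}.$$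
   Context: Let $M=K+L$ and $p\in\mathbb{N}$, where $\mathbb{N}=\{0,1,2,\dots\}$. The random vector $\boldsymbol{X}=(\boldsymbol{\theta},\boldsymbol{\xi})$ has $M$ mutually independent real components, each with a probability density having finite moments of all orders; $\boldsymbol{\theta}=(\theta_1,\dots,\theta_K)$ collects the epistemic variables and $\boldsymbol{\xi}=(\xi_1,\dots,\xi_L)$ the aleatory ones. Since the components are independent, the conditional law of $\boldsymbol{\xi}$ given $\boldsymbol{\theta}$ is the law of $\boldsymbol{\xi}$. For each component there is a family of univariate polynomials $(\phi_k)_{k\in\mathbb{N}}$ (possibly different for each component), with $\phi_k$ of degree $k$ and $\phi_0=1$, orthonormal in $L^2$ of the law of that component (e.g. normalized Legendre polynomials for the uniform law on $[-1,1]$). For a multi-index $\boldsymbol{\alpha}\in\mathbb{N}^M$, $\Psi_{\boldsymbol{\alpha}}$ denotes the product of the univariate polynomials of degree $\alpha_i$ in the $i$-th component; $\Psi_{\boldsymbol{\alpha}_K}(\boldsymbol{\theta})$ and $\Psi_{\boldsymbol{\alpha}_L}(\boldsymbol{\xi})$ denote the corresponding products over the components of $\boldsymbol{\theta}$ and of $\boldsymbol{\xi}$ only. The truncation set is $\mathcal{A}^{M,p}=\{\boldsymbol{\alpha}\in\mathbb{N}^M:|\boldsymbol{\alpha}|\le p\}$, with $|\boldsymbol{\alpha}|=\sum_i\alpha_i$. The symbol $\delta$ is the Kronecker delta. *)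

theory Defs
  imports "HOL-Probability.Probability" "HOL-Computational_Algebra.Polynomial"
begin

text \<open>
  Vectors and multi-indices of length \<open>n\<close> are extensional functions on \<open>{..<n}\<close>, so components
  are numbered from \<open>0\<close>. The space \<open>\<real>\<^sup>n\<close> with its Borel sets is the product measurable space
  \<open>vec_borel n\<close>.
\<close>

abbreviation vecs :: "nat \<Rightarrow> (nat \<Rightarrow> 'a) set" where
  "vecs n \<equiv> {..<n} \<rightarrow>\<^sub>E UNIV"

abbreviation vec_borel :: "nat \<Rightarrow> (nat \<Rightarrow> real) measure" where
  "vec_borel n \<equiv> (\<Pi>\<^sub>M i\<in>{..<n}. borel)"

text \<open>The concatenation \<open>(a, b)\<close> of a vector of length \<open>K\<close> and one of length \<open>L\<close>.\<close>

definition vec_append :: "nat \<Rightarrow> nat \<Rightarrow> (nat \<Rightarrow> 'a) \<Rightarrow> (nat \<Rightarrow> 'a) \<Rightarrow> (nat \<Rightarrow> 'a)" where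
  "vec_append K L a b = (\<lambda>i\<in>{..<K + L}. if i < K then a i else b (i - K))"

text \<open>The truncation set \<open>\<A>\<^sup>n\<^sup>,\<^sup>p\<close>.\<close>

definition trunc_set :: "nat \<Rightarrow> nat \<Rightarrow> (nat \<Rightarrow> nat) set" where
  "trunc_set n p = {\<alpha> \<in> vecs n. (\<Sum>i<n. \<alpha> i) \<le> p}"

text \<open>\<open>\<phi> i k\<close> is the polynomial of degree \<open>k\<close> belonging to the \<open>i\<close>-th component.\<close>

definition Psi :: "nat \<Rightarrow> (nat \<Rightarrow> nat \<Rightarrow> real poly) \<Rightarrow> (nat \<Rightarrow> nat) \<Rightarrow> (nat \<Rightarrow> real) \<Rightarrow> real" where
  "Psi n \<phi> \<alpha> x = (\<Prod>i<n. poly (\<phi> i (\<alpha> i)) (x i))"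

definition PCE ::
    "nat \<Rightarrow> nat \<Rightarrow> (nat \<Rightarrow> nat \<Rightarrow> real poly) \<Rightarrow> ((nat \<Rightarrow> nat) \<Rightarrow> real) \<Rightarrow> (nat \<Rightarrow> real) \<Rightarrow> real" where
  "PCE n p \<phi> y x = (\<Sum>\<alpha>\<in>trunc_set n p. y \<alpha> * Psi n \<phi> \<alpha> x)"

text \<open>The coefficient \<open>c\<close> at \<open>\<alpha>L\<close>, as a function of the epistemic variables \<open>\<theta>\<close>.\<close>

definition cond_coeff ::
    "nat \<Rightarrow> nat \<Rightarrow> nat \<Rightarrow> (nat \<Rightarrow> nat \<Rightarrow> real poly) \<Rightarrow> ((nat \<Rightarrow> nat) \<Rightarrow> real) \<Rightarrow>
     (nat \<Rightarrow> nat) \<Rightarrow> (nat \<Rightarrow> real) \<Rightarrow> real" where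
  "cond_coeff K L p \<phi> y \<alpha>L \<theta> =
    (\<Sum>\<alpha>K\<in>{\<alpha>K \<in> vecs K. vec_append K L \<alpha>K \<alpha>L \<in> trunc_set (K + L) p}.
       y (vec_append K L \<alpha>K \<alpha>L) * Psi K \<phi> \<alpha>K \<theta>)"

text \<open>
  Membership in \<open>L\<^sup>2\<close> is required explicitly, since the Bochner integral of a non-integrable
  function is \<open>0\<close>.
\<close>

definition orthonormal_L2 :: "'a measure \<Rightarrow> 'i set \<Rightarrow> ('i \<Rightarrow> 'a \<Rightarrow> real) \<Rightarrow> bool" where
  "orthonormal_L2 N I f \<longleftrightarrow>
    (\<forall>i\<in>I. f i \<in> borel_measurable N \<and> integrable N (\<lambda>x. (f i x)\<^sup>2)) \<and>
    (\<forall>i\<in>I. \<forall>j\<in>I. (\<integral>x. f i x * f j x \<partial>N) = of_bool (i = j))"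

text \<open>
  \<open>\<kappa>\<close> is a regular conditional law of the \<open>T\<close>-valued random variable \<open>Y\<close> given the
  \<open>S\<close>-valued random variable \<open>X\<close>.
\<close>

definition regular_cond_law ::
    "'w measure \<Rightarrow> 'a measure \<Rightarrow> 'b measure \<Rightarrow> ('w \<Rightarrow> 'a) \<Rightarrow> ('w \<Rightarrow> 'b) \<Rightarrow> ('a \<Rightarrow> 'b measure) \<Rightarrow> bool" where
  "regular_cond_law \<Omega> S T X Y \<kappa> \<longleftrightarrow>
    X \<in> measurable \<Omega> S \<and> Y \<in> measurable \<Omega> T \<and> \<kappa> \<in> measurable S (prob_algebra T) \<and>
    (\<forall>A\<in>sets S. \<forall>B\<in>sets T.
       emeasure \<Omega> {\<omega> \<in> space \<Omega>. X \<omega> \<in> A \<and> Y \<omega> \<in> B} =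
       (\<integral>\<^sup>+x\<in>A. emeasure (\<kappa> x) B \<partial>distr \<Omega> S X))"

text \<open>The first \<open>K\<close> and the last \<open>L\<close> components of the random vector \<open>X\<close>.\<close>

definition epistemic :: "nat \<Rightarrow> (nat \<Rightarrow> 'w \<Rightarrow> real) \<Rightarrow> 'w \<Rightarrow> (nat \<Rightarrow> real)" where
  "epistemic K X \<omega> = (\<lambda>i\<in>{..<K}. X i \<omega>)"

definition aleatory :: "nat \<Rightarrow> nat \<Rightarrow> (nat \<Rightarrow> 'w \<Rightarrow> real) \<Rightarrow> 'w \<Rightarrow> (nat \<Rightarrow> real)" where
  "aleatory K L X \<omega> = (\<lambda>j\<in>{..<L}. X (K + j) \<omega>)"

end

theory Submission
  imports Defs
begin

text \<open>
  Splitting multi-indices turns the expansion into an iterated sum. The blocks \<open>\<theta>\<close> and \<open>\<xi>\<close> are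
  independent, so the law of \<open>\<xi>\<close> is a constant conditional law given \<open>\<theta>\<close>; and by independence
  within \<open>\<xi>\<close> the expectation of \<open>\<Psi>\<^sub>\<alpha> \<Psi>\<^sub>\<beta>\<close> factors into the univariate inner products
  \<open>\<delta>\<close> of \<open>\<alpha> i\<close> and \<open>\<beta> i\<close>.
\<close>

section \<open>Concatenated multi-indices and the regrouped expansion\<close>

lemma prod_lessThan_add:
  "(\<Prod>i<m + n. f i) = (\<Prod>i<m. f i) * (\<Prod>j<n. f (m + j))"
  for f :: "nat \<Rightarrow> 'a::comm_monoid_mult"
  by (induction n) (simp_all add: mult.assoc)

lemma sum_lessThan_add:
  "(\<Sum>i<m + n. f i) = (\<Sum>i<m. f i) + (\<Sum>j<n. f (m + j))"
  for f :: "nat \<Rightarrow> 'a::comm_monoid_add"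
  by (induction n) (simp_all add: add.assoc)

lemma vec_append_nth [simp]:
  "i < K \<Longrightarrow> vec_append K L a b i = a i"
  "j < L \<Longrightarrow> vec_append K L a b (K + j) = b j"
  by (simp_all add: vec_append_def)

lemma vec_append_in_vecs [simp]: "vec_append K L a b \<in> vecs (K + L)"
  by (simp add: vec_append_def)

text \<open>Together with the next two lemmas, this makes concatenation and cutting at
  \<open>K\<close> mutually inverse. Beyond the length both sides are \<open>undefined\<close>, by
  extensionality of \<open>a\<close>.\<close>

lemma vec_append_split:
  assumes "a \<in> vecs (K + L)"
  shows "vec_append K L (restrict a {..<K}) (\<lambda>j\<in>{..<L}. a (K + j)) = a"
proof
  fix i
  show "vec_append K L (restrict a {..<K}) (\<lambda>j\<in>{..<L}. a (K + j)) i = a i"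
    using PiE_arb[OF assms, of i] by (cases "i < K + L") (auto simp: vec_append_def)
qed

lemma restrict_vec_append:
  assumes "a \<in> vecs K"
  shows "restrict (vec_append K L a b) {..<K} = a"
proof
  fix i
  show "restrict (vec_append K L a b) {..<K} i = a i"
    using PiE_arb[OF assms, of i] by (cases "i < K") auto
qed

lemma shift_vec_append:
  assumes "b \<in> vecs L"
  shows "(\<lambda>j\<in>{..<L}. vec_append K L a b (K + j)) = b"
proof
  fix j
  show "(\<lambda>j\<in>{..<L}. vec_append K L a b (K + j)) j = b j"
    using PiE_arb[OF assms, of j] by (cases "j < L") auto
qed

text \<open>Total degree is additive over the two blocks, so the truncation couples them only
  through the sum of their degrees.\<close>

lemma vec_append_in_trunc_set_iff:
  "vec_append K L a b \<in> trunc_set (K + L) p \<longleftrightarrow> (\<Sum>i<K. a i) + (\<Sum>j<L. b j) \<le> p"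
  by (simp add: trunc_set_def sum_lessThan_add)

text \<open>Every entry is bounded by the total degree, so the set lies in a finite box. Merging the
  iterated sums into one sum over pairs relies on this finiteness.\<close>

lemma finite_trunc_set: "finite (trunc_set n p)"
proof (rule finite_subset)
  show "trunc_set n p \<subseteq> {..<n} \<rightarrow>\<^sub>E {..p}"
  proof
    fix a assume a: "a \<in> trunc_set n p"
    have "a i \<le> p" if "i < n" for i
    proof -
      have "a i \<le> (\<Sum>i<n. a i)"
        using that by (intro member_le_sum) auto
      then show ?thesis
        using a by (simp add: trunc_set_def)
    qed
    then show "a \<in> {..<n} \<rightarrow>\<^sub>E {..p}"
      using a by (auto simp: trunc_set_def PiE_iff)
  qed
qed (rule finite_PiE, simp_all)

lemma Psi_vec_append:
  "Psi (K + L) \<phi> (vec_append K L a b) (vec_append K L \<theta> \<xi>) =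
    Psi K \<phi> a \<theta> * Psi L (\<lambda>j. \<phi> (K + j)) b \<xi>"
  by (simp add: Psi_def prod_lessThan_add)

text \<open>The truncation set is fibred over the last \<open>L\<close> entries, with fibre
  \<open>S b\<close> over \<open>b\<close>. Terms in one fibre share the factor in \<xi>; what
  remains after factoring it out is \<open>cond_coeff\<close>.\<close>

lemma PCE_vec_append:
  "PCE (K + L) p \<phi> y (vec_append K L \<theta> \<xi>) =
    (\<Sum>b\<in>trunc_set L p. cond_coeff K L p \<phi> y b \<theta> * Psi L (\<lambda>j. \<phi> (K + j)) b \<xi>)"
proof -
  define S where "S b = {a \<in> vecs K. vec_append K L a b \<in> trunc_set (K + L) p}" for b
  have S_iff: "a \<in> S b \<longleftrightarrow> a \<in> vecs K \<and> (\<Sum>i<K. a i) + (\<Sum>j<L. b j) \<le> p" for a b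
    by (simp only: S_def mem_Collect_eq vec_append_in_trunc_set_iff)
  \<comment> \<open>Dropping the degree of \<open>b\<close> keeps the bound \<open>p\<close>, so
    each fibre lies in \<open>trunc_set K p\<close>.\<close>
  have fin: "finite (S b)" for b
  proof (rule finite_subset[OF _ finite_trunc_set[of K p]], rule subsetI)
    show "a \<in> trunc_set K p" if "a \<in> S b" for a
      using that unfolding S_iff trunc_set_def by simp
  qed
  have "(\<Sum>b\<in>trunc_set L p. cond_coeff K L p \<phi> y b \<theta> * Psi L (\<lambda>j. \<phi> (K + j)) b \<xi>) =
      (\<Sum>b\<in>trunc_set L p. \<Sum>a\<in>S b.
        y (vec_append K L a b) * Psi (K + L) \<phi> (vec_append K L a b) (vec_append K L \<theta> \<xi>))"
    by (simp add: cond_coeff_def S_def sum_distrib_right Psi_vec_append mult.assoc)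
  also have "\<dots> = (\<Sum>(b, a)\<in>Sigma (trunc_set L p) S.
      y (vec_append K L a b) * Psi (K + L) \<phi> (vec_append K L a b) (vec_append K L \<theta> \<xi>))"
    using fin finite_trunc_set by (intro sum.Sigma) auto
  \<comment> \<open>Reindexing by concatenation, with cutting at \<open>K\<close> as inverse. The
    tail of a multi-index of degree at most \<open>p\<close> again has degree at most
    \<open>p\<close>, so the cut lands in the outer index set.\<close>
  also have "\<dots> = PCE (K + L) p \<phi> y (vec_append K L \<theta> \<xi>)"
    unfolding PCE_def
  proof (rule sum.reindex_bij_witness[where
        i = "\<lambda>\<alpha>. (\<lambda>j\<in>{..<L}. \<alpha> (K + j), restrict \<alpha> {..<K})" and
        j = "\<lambda>(b, a). vec_append K L a b"])
    fix ba assume "ba \<in> Sigma (trunc_set L p) S"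
    then obtain b a where ba: "ba = (b, a)" "b \<in> vecs L" "a \<in> vecs K" "a \<in> S b"
      by (cases ba) (simp add: S_iff trunc_set_def)
    show "(case ba of (b, a) \<Rightarrow> vec_append K L a b) \<in> trunc_set (K + L) p"
      using ba(4) by (simp add: ba(1) S_def)
    show "(\<lambda>j\<in>{..<L}. (case ba of (b, a) \<Rightarrow> vec_append K L a b) (K + j),
        restrict (case ba of (b, a) \<Rightarrow> vec_append K L a b) {..<K}) = ba"
      using ba(2,3) by (simp only: ba(1) prod.case restrict_vec_append shift_vec_append)
  next
    fix \<alpha> assume "\<alpha> \<in> trunc_set (K + L) p"
    then have \<alpha>: "\<alpha> \<in> vecs (K + L)" "(\<Sum>i<K. \<alpha> i) + (\<Sum>j<L. \<alpha> (K + j)) \<le> p"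
      by (simp_all add: trunc_set_def sum_lessThan_add)
    then show "(\<lambda>j\<in>{..<L}. \<alpha> (K + j), restrict \<alpha> {..<K}) \<in> Sigma (trunc_set L p) S"
      by (simp add: S_iff trunc_set_def)
    show "(case (\<lambda>j\<in>{..<L}. \<alpha> (K + j), restrict \<alpha> {..<K}) of (b, a) \<Rightarrow> vec_append K L a b) = \<alpha>"
      using vec_append_split[OF \<alpha>(1)] by simp
  qed (simp add: split_beta)
  finally show ?thesis ..
qed

section \<open>Integrability and measurability of products of polynomials\<close>

text \<open>The product is dominated pointwise by the sum of the squares, by the
  arithmetic-geometric mean inequality.\<close>

lemma integrable_mult_square:
  fixes f g :: "'a \<Rightarrow> real"
  assumes "f \<in> borel_measurable M" "g \<in> borel_measurable M"
    and "integrable M (\<lambda>x. (f x)\<^sup>2)" "integrable M (\<lambda>x. (g x)\<^sup>2)"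
  shows "integrable M (\<lambda>x. f x * g x)"
proof (rule Bochner_Integration.integrable_bound)
  show "integrable M (\<lambda>x. (f x)\<^sup>2 + (g x)\<^sup>2)"
    using assms by simp
  have "\<bar>u * v\<bar> \<le> u\<^sup>2 + v\<^sup>2" for u v :: real
  proof -
    have "\<bar>u * v\<bar> \<le> 2 * \<bar>u\<bar> * \<bar>v\<bar>"
      by (simp add: abs_mult)
    also have "\<dots> \<le> u\<^sup>2 + v\<^sup>2"
      using sum_squares_bound[of "\<bar>u\<bar>" "\<bar>v\<bar>"] by simp
    finally show ?thesis .
  qed
  then show "AE x in M. norm (f x * g x) \<le> norm ((f x)\<^sup>2 + (g x)\<^sup>2)"
    by simp
qed (use assms in measurable)

lemma borel_measurable_poly [measurable]:
  "poly q \<in> borel_measurable borel" for q :: "real poly"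
  by (intro borel_measurable_continuous_onI continuous_intros)

lemma borel_measurable_Psi [measurable]: "Psi n \<phi> \<alpha> \<in> borel_measurable (vec_borel n)"
  unfolding Psi_def by measurable

section \<open>Orthonormality of products of univariate polynomials\<close>

context prob_space
begin

text \<open>The integrand is the product over \<open>i\<close> of \<open>W i\<close>, a function of
  \<open>Z i\<close> alone. Independence therefore yields integrability and factors the
  expectation.\<close>

lemma
  fixes Z :: "nat \<Rightarrow> 'a \<Rightarrow> real"
  assumes indep: "indep_vars (\<lambda>_. borel) Z {..<n}"
    and orth: "\<And>i. i < n \<Longrightarrow> orthonormal_L2 (distr M borel (Z i)) UNIV (\<lambda>k. poly (\<phi> i k))"
    and a: "a \<in> vecs n" and b: "b \<in> vecs n"
  shows integrable_Psi_mult: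
      "integrable M (\<lambda>\<omega>. Psi n \<phi> a (\<lambda>i\<in>{..<n}. Z i \<omega>) * Psi n \<phi> b (\<lambda>i\<in>{..<n}. Z i \<omega>))"
    and expectation_Psi_mult:
      "expectation (\<lambda>\<omega>. Psi n \<phi> a (\<lambda>i\<in>{..<n}. Z i \<omega>) * Psi n \<phi> b (\<lambda>i\<in>{..<n}. Z i \<omega>)) =
        of_bool (a = b)"
proof -
  define W where "W i \<omega> = poly (\<phi> i (a i)) (Z i \<omega>) * poly (\<phi> i (b i)) (Z i \<omega>)" for i \<omega>
  have Psi_eq: "Psi n \<phi> a (\<lambda>i\<in>{..<n}. Z i \<omega>) * Psi n \<phi> b (\<lambda>i\<in>{..<n}. Z i \<omega>) = (\<Prod>i<n. W i \<omega>)"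
    for \<omega> by (simp add: Psi_def W_def prod.distrib)
  have Z [measurable]: "Z i \<in> borel_measurable M" if "i < n" for i
    using indep that by (auto simp: indep_vars_def)
  have W_indep: "indep_vars (\<lambda>_. borel) W {..<n}"
    unfolding W_def
    by (rule indep_vars_compose2[OF indep, where Y = "\<lambda>i z. poly (\<phi> i (a i)) z * poly (\<phi> i (b i)) z"])
      measurable
  \<comment> \<open>The product rule for independent variables needs integrable factors; these come
    from the univariate square-integrability, pulled back along \<open>Z i\<close>.\<close>
  have W_int: "integrable M (W i)" if "i < n" for i
  proof -
    have "integrable (distr M borel (Z i)) (\<lambda>z. poly (\<phi> i (a i)) z * poly (\<phi> i (b i)) z)"
      using orth[OF that] by (intro integrable_mult_square) (auto simp: orthonormal_L2_def)
    then show ?thesis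
      using that by (subst (asm) integrable_distr_eq) (auto simp: W_def[abs_def])
  qed
  have W_exp: "expectation (W i) = of_bool (a i = b i)" if "i < n" for i
  proof -
    have "expectation (W i) =
        (\<integral>z. poly (\<phi> i (a i)) z * poly (\<phi> i (b i)) z \<partial>distr M borel (Z i))"
      using that by (subst integral_distr) (auto simp: W_def[abs_def])
    then show ?thesis
      using orth[OF that] by (simp add: orthonormal_L2_def)
  qed
  show "integrable M (\<lambda>\<omega>. Psi n \<phi> a (\<lambda>i\<in>{..<n}. Z i \<omega>) * Psi n \<phi> b (\<lambda>i\<in>{..<n}. Z i \<omega>))"
    unfolding Psi_eq using W_indep W_int by (intro indep_vars_integrable) auto
  have "expectation (\<lambda>\<omega>. \<Prod>i<n. W i \<omega>) = (\<Prod>i<n. expectation (W i))"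
    using W_indep W_int by (intro indep_vars_lebesgue_integral) auto
  also have "\<dots> = (\<Prod>i<n. of_bool (a i = b i))"
    using W_exp by simp
  also have "\<dots> = of_bool (\<forall>i<n. a i = b i)"
    by (auto simp: of_bool_def)
  \<comment> \<open>Extensional functions that agree below \<open>n\<close> are equal. For
    \<open>n = 0\<close> this matches the empty product \<open>1\<close>.\<close>
  also have "(\<forall>i<n. a i = b i) \<longleftrightarrow> a = b"
    using PiE_ext[OF a b] by auto
  finally show "expectation (\<lambda>\<omega>. Psi n \<phi> a (\<lambda>i\<in>{..<n}. Z i \<omega>) * Psi n \<phi> b (\<lambda>i\<in>{..<n}. Z i \<omega>)) =
      of_bool (a = b)"
    unfolding Psi_eq .
qed

text \<open>The preceding facts are transported to the law of the vector; square-integrability is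
  the integrability statement with \<open>a = b\<close>.\<close>

lemma orthonormal_L2_Psi:
  fixes Z :: "nat \<Rightarrow> 'a \<Rightarrow> real"
  assumes indep: "indep_vars (\<lambda>_. borel) Z {..<n}"
    and orth: "\<And>i. i < n \<Longrightarrow> orthonormal_L2 (distr M borel (Z i)) UNIV (\<lambda>k. poly (\<phi> i k))"
  shows "orthonormal_L2 (distr M (vec_borel n) (\<lambda>\<omega>. \<lambda>i\<in>{..<n}. Z i \<omega>)) (vecs n) (Psi n \<phi>)"
proof -
  have [measurable]: "(\<lambda>\<omega>. \<lambda>i\<in>{..<n}. Z i \<omega>) \<in> measurable M (vec_borel n)"
    using indep by (intro measurable_restrict) (auto simp: indep_vars_def)
  show ?thesis
    using integrable_Psi_mult[OF indep orth] expectation_Psi_mult[OF indep orth]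
    by (auto simp: orthonormal_L2_def integrable_distr_eq integral_distr power2_eq_square)
qed

section \<open>Independence of the two blocks and the conditional law\<close>

text \<open>Independence makes the joint law a product measure. The measure of a rectangle then
  factors, which is the integral over \<open>A\<close> of a constant.\<close>

lemma regular_cond_law_indep_var:
  assumes indep: "indep_var S X T Y"
  shows "regular_cond_law M S T X Y (\<lambda>_. distr M T Y)"
proof -
  have X [measurable]: "X \<in> measurable M S" and Y [measurable]: "Y \<in> measurable M T"
    using indep by (rule indep_var_rv1, rule indep_var_rv2)
  have "emeasure M {\<omega> \<in> space M. X \<omega> \<in> A \<and> Y \<omega> \<in> B} =
      (\<integral>\<^sup>+x\<in>A. emeasure (distr M T Y) B \<partial>distr M S X)"
    if A [measurable]: "A \<in> sets S" and B [measurable]: "B \<in> sets T" for A B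
  proof -
    have "{\<omega> \<in> space M. X \<omega> \<in> A \<and> Y \<omega> \<in> B} = (\<lambda>\<omega>. (X \<omega>, Y \<omega>)) -` (A \<times> B) \<inter> space M"
      by auto
    then have "emeasure M {\<omega> \<in> space M. X \<omega> \<in> A \<and> Y \<omega> \<in> B} =
        emeasure (distr M (S \<Otimes>\<^sub>M T) (\<lambda>\<omega>. (X \<omega>, Y \<omega>))) (A \<times> B)"
      by (simp add: emeasure_distr)
    also have "\<dots> = emeasure (distr M S X \<Otimes>\<^sub>M distr M T Y) (A \<times> B)"
      using indep by (simp add: indep_var_distribution_eq)
    also have "\<dots> = emeasure (distr M S X) A * emeasure (distr M T Y) B"
    proof -
      \<comment> \<open>This supplies the sigma-finiteness of the second factor behind the rectangle
        formula.\<close>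
      interpret Y: prob_space "distr M T Y"
        by (rule prob_space_distr) (rule Y)
      show ?thesis
        by (rule Y.emeasure_pair_measure_Times) auto
    qed
    also have "\<dots> = (\<integral>\<^sup>+x\<in>A. emeasure (distr M T Y) B \<partial>distr M S X)"
      by (subst nn_integral_cmult_indicator) (simp_all add: mult.commute)
    finally show ?thesis .
  qed
  moreover have "(\<lambda>_. distr M T Y) \<in> measurable S (prob_algebra T)"
    by (intro measurable_const) (simp add: space_prob_algebra prob_space_distr)
  ultimately show ?thesis
    by (simp add: regular_cond_law_def)
qed

text \<open>Disjoint blocks of an independent family are independent. The second block is indexed by
  \<open>{K..<K + L}\<close>, so it is moved to \<open>{..<L}\<close> by a measurable shift.\<close>

lemma indep_var_epistemic_aleatory:
  assumes indep: "indep_vars (\<lambda>_. borel) X {..<K + L}"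
  shows "indep_var (vec_borel K) (epistemic K X) (vec_borel L) (aleatory K L X)"
proof -
  have "indep_var (\<Pi>\<^sub>M i\<in>{..<K}. borel) (\<lambda>\<omega>. restrict (\<lambda>i. X i \<omega>) {..<K})
      (\<Pi>\<^sub>M i\<in>{K..<K + L}. borel) (\<lambda>\<omega>. restrict (\<lambda>i. X i \<omega>) {K..<K + L})"
    by (rule indep_var_restrict[OF indep]) auto
  moreover have "(\<lambda>x. \<lambda>j\<in>{..<L}. x (K + j)) \<in>
      measurable (\<Pi>\<^sub>M i\<in>{K..<K + L}. (borel :: real measure)) (vec_borel L)"
    by (intro measurable_restrict measurable_component_singleton) auto
  \<comment> \<open>The identity on the first block serves only to compose both sides with
    measurable maps at once.\<close>
  ultimately have "indep_var (vec_borel K) ((\<lambda>x. x) \<circ> (\<lambda>\<omega>. restrict (\<lambda>i. X i \<omega>) {..<K}))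
      (vec_borel L) ((\<lambda>x. \<lambda>j\<in>{..<L}. x (K + j)) \<circ> (\<lambda>\<omega>. restrict (\<lambda>i. X i \<omega>) {K..<K + L}))"
    by (intro indep_var_compose) auto
  also have "(\<lambda>x. x) \<circ> (\<lambda>\<omega>. restrict (\<lambda>i. X i \<omega>) {..<K}) = epistemic K X"
    by (simp add: fun_eq_iff epistemic_def)
  also have "(\<lambda>x. \<lambda>j\<in>{..<L}. x (K + j)) \<circ> (\<lambda>\<omega>. restrict (\<lambda>i. X i \<omega>) {K..<K + L}) =
      aleatory K L X"
    by (simp add: fun_eq_iff aleatory_def)
  finally show ?thesis .
qed

end

theorem lemma3p1:
  fixes \<Omega> :: "'w measure"
    and K L p :: nat
    and X :: "nat \<Rightarrow> 'w \<Rightarrow> real"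
    and \<phi> :: "nat \<Rightarrow> nat \<Rightarrow> real poly"
    and y :: "(nat \<Rightarrow> nat) \<Rightarrow> real"
  defines "\<phi>L \<equiv> (\<lambda>j. \<phi> (K + j))"
    and "law_\<xi> \<equiv> distr \<Omega> (vec_borel L) (aleatory K L X)"
  assumes "prob_space \<Omega>"
    and "prob_space.indep_vars \<Omega> (\<lambda>_. borel) X {..<K + L}"
    and "\<And>i. i < K + L \<Longrightarrow> \<exists>f. distributed \<Omega> lborel (X i) f"
    and "\<And>i n. i < K + L \<Longrightarrow> integrable \<Omega> (\<lambda>\<omega>. X i \<omega> ^ n)"
    and "\<And>i k. i < K + L \<Longrightarrow> degree (\<phi> i k) = k"
    and "\<And>i. i < K + L \<Longrightarrow> \<phi> i 0 = 1"
    and "\<And>i. i < K + L \<Longrightarrow> orthonormal_L2 (distr \<Omega> borel (X i)) UNIV (\<lambda>k. poly (\<phi> i k))"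
  shows "(\<forall>\<alpha>K \<in> vecs K. \<forall>\<alpha>L \<in> vecs L. \<forall>\<theta> \<in> vecs K. \<forall>\<xi> \<in> vecs L.
            Psi (K + L) \<phi> (vec_append K L \<alpha>K \<alpha>L) (vec_append K L \<theta> \<xi>) =
            Psi K \<phi> \<alpha>K \<theta> * Psi L \<phi>L \<alpha>L \<xi>)
       \<and> (\<forall>\<theta> \<in> vecs K. \<forall>\<xi> \<in> vecs L.
            PCE (K + L) p \<phi> y (vec_append K L \<theta> \<xi>) =
            (\<Sum>\<alpha>L\<in>trunc_set L p. cond_coeff K L p \<phi> y \<alpha>L \<theta> * Psi L \<phi>L \<alpha>L \<xi>))
       \<and> regular_cond_law \<Omega> (vec_borel K) (vec_borel L) (epistemic K X) (aleatory K L X) (\<lambda>_. law_\<xi>)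
       \<and> orthonormal_L2 law_\<xi> (trunc_set L p) (Psi L \<phi>L)
       \<and> (\<forall>\<alpha>L \<in> trunc_set L p. \<forall>\<beta>L \<in> trunc_set L p.
            prob_space.expectation \<Omega>
              (\<lambda>\<omega>. Psi L \<phi>L \<alpha>L (aleatory K L X \<omega>) * Psi L \<phi>L \<beta>L (aleatory K L X \<omega>)) =
            of_bool (\<alpha>L = \<beta>L))"
proof -
  interpret prob_space \<Omega> by fact
  note indep = assms(4)
  have aleatory_eq: "aleatory K L X = (\<lambda>\<omega>. \<lambda>j\<in>{..<L}. X (K + j) \<omega>)"
    by (simp add: fun_eq_iff aleatory_def)
  \<comment> \<open>The family is renumbered from \<open>0\<close> by taking the disjoint singleton
    blocks \<open>{K + j}\<close> and then evaluating each block at its only coordinate.\<close>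
  have "indep_vars (\<lambda>j. \<Pi>\<^sub>M i\<in>{K + j}. borel) (\<lambda>j \<omega>. restrict (\<lambda>i. X i \<omega>) {K + j}) {..<L}"
    by (rule indep_vars_restrict[OF indep]) (auto simp: disjoint_family_on_def)
  then have "indep_vars (\<lambda>_. borel) (\<lambda>j \<omega>. restrict (\<lambda>i. X i \<omega>) {K + j} (K + j)) {..<L}"
    by (rule indep_vars_compose2) (auto intro: measurable_component_singleton)
  then have indepL: "indep_vars (\<lambda>_. borel) (\<lambda>j. X (K + j)) {..<L}"
    by simp
  have orthL: "orthonormal_L2 (distr \<Omega> borel (X (K + j))) UNIV (\<lambda>k. poly (\<phi>L j k))"
    if "j < L" for j
    using assms(9) that by (simp add: \<phi>L_def)
  have trunc: "\<alpha> \<in> vecs L" if "\<alpha> \<in> trunc_set L p" for \<alpha>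
    using that by (simp add: trunc_set_def)
  \<comment> \<open>Orthonormality holds over all multi-indices of length \<open>L\<close> and is
    inherited by the truncated set.\<close>
  have "orthonormal_L2 law_\<xi> (trunc_set L p) (Psi L \<phi>L)"
    using orthonormal_L2_Psi[OF indepL orthL] trunc
    by (auto simp: law_\<xi>_def aleatory_eq orthonormal_L2_def)
  moreover have "regular_cond_law \<Omega> (vec_borel K) (vec_borel L) (epistemic K X) (aleatory K L X)
      (\<lambda>_. law_\<xi>)"
    unfolding law_\<xi>_def
    by (rule regular_cond_law_indep_var[OF indep_var_epistemic_aleatory[OF indep]])
  moreover have "expectation
      (\<lambda>\<omega>. Psi L \<phi>L \<alpha>L (aleatory K L X \<omega>) * Psi L \<phi>L \<beta>L (aleatory K L X \<omega>)) =
      of_bool (\<alpha>L = \<beta>L)" if "\<alpha>L \<in> trunc_set L p" "\<beta>L \<in> trunc_set L p" for \<alpha>L \<beta>L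
    unfolding aleatory_eq
    using expectation_Psi_mult[OF indepL orthL trunc[OF that(1)] trunc[OF that(2)]] .
  ultimately show ?thesis
    by (simp add: Psi_vec_append PCE_vec_append \<phi>L_def)
qed

end
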